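(* Let $R$ be a commutative ring with unity, let $m\ge1$ be an integer, and let $\lambda_1:\mathbb N\times\mathbb Z\to R$ be a lambda-recursive family of order $m$ with principal factor $(p_n)_{n\ge m}$ and auxiliary factor $h_{(n,k)}=h_n$ independent of $k$. Assume that $\lambda_1(n,0)\in R^\times$ for all $n\ge0$ and $p_n\in R^\times$ for all $n\ge m$. Let $$f_n(x)=\sum_{b=0}^{w_m(n)}\lambda_1(n,b)\,x^{n-mb}\qquad(n\in\mathbb N),$$ and assume that there exists a family $\lambda_3:\mathbb N\times\mathbb Z\to R$ with triangular support of order $m$ such that, for all $n\in\mathbb N$, $$x^n=\sum_{b=0}^{w_m(n)}\lambda_3(n,b)\,f_{n-mb}(x),\qquad \lambda_1(n,0)\,\lambda_3(n,0)=1.$$ For each pair $(n,k)$ write $t=n-km$ and $s=n-(k-1)m$. Then, for all $n\in\mathbb N$ and all $0\le k\le w_m(n)$, $$\lambda_3(n,k)=\begin{cases}\dfrac{1}{\lambda_1(n,0)},&k=0,\\[8pt] A(n,k)\,\lambda_3(n-1,k)+\dfrac{h_s}{p_s}\,\lambda_3(n-1,k-1),&1\le k\le w_m(n),\end{cases}$$ where $$A(n,k)=\begin{cases}\dfrac{1}{p_t},&t\ge m,\\[6pt] \dfrac{\lambda_1(t-1,0)}{\lambda_1(t,0)},&t\in\{1,\dots,m-1\},\\[8pt] 0,&t=0.\end{cases}$$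
   Context: $\mathbb N=\{0,1,2,\dots\}$, $w_m(n)=\lfloor n/m\rfloor$, and $R^\times$ is the group of units of $R$. A family $\lambda:\mathbb N\times\mathbb Z\to R$ has triangular support of order $m$ (written $\lambda\in\Delta_m$) if $\lambda(n,k)=0$ whenever $k<0$ or $k>w_m(n)$. A family $\lambda_1\in\Delta_m$ is lambda-recursive of order $m$ if there exist $p_n\in R$ (principal factor), $h_{(n,k)}\in R$ (auxiliary factor) and initial data $c_n\in R$ for $0\le n\le m-1$ such that, for all $n\in\mathbb N$ and $0\le k\le w_m(n)$: $\lambda_1(n,0)=c_n$ if $0\le n\le m-1$ (and $k=0$), and $\lambda_1(n,k)=p_n\,\lambda_1(n-1,k)-h_{(n,k)}\,\lambda_1(n-m,k-1)$ if $n\ge m$. *)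

theory Defs
  imports "HOL-Computational_Algebra.Polynomial"
begin

text \<open>
  The coefficient ring has sort \<open>{comm_ring, comm_monoid_mult}\<close>: a commutative ring with unity.
  The class \<open>comm_ring_1\<close> would in addition impose \<open>0 \<noteq> 1\<close>. The units are the
  elements \<open>a\<close> with \<open>a dvd 1\<close>.
\<close>

definition unit_inv :: "'a::comm_monoid_mult \<Rightarrow> 'a" where
  "unit_inv a = (THE b. a * b = 1)"

lemma unit_inv_mult:
  fixes a :: "'a::comm_monoid_mult"
  assumes "a dvd 1"
  shows "a * unit_inv a = 1"
proof -
  obtain b where b: "a * b = 1"
    using assms by (metis dvd_def)
  have "c = b" if "a * c = 1" for c
    using b that by (metis mult.assoc mult.commute mult_1)
  then show ?thesis
    unfolding unit_inv_def using b by (metis (mono_tags, lifting) theI)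
qed

definition triangular_support :: "nat \<Rightarrow> (nat \<Rightarrow> int \<Rightarrow> 'a::zero) \<Rightarrow> bool" where
  "triangular_support m lam \<longleftrightarrow>
     (\<forall>n k. k < 0 \<or> k > int (n div m) \<longrightarrow> lam n k = 0)"

text \<open>
  \<open>p\<close> is the principal factor, \<open>h\<close> the auxiliary factor and \<open>c\<close> the initial data.
  Only the values \<open>p n\<close> and \<open>h n k\<close> with \<open>n \<ge> m\<close> and \<open>c n\<close> with \<open>n < m\<close> matter.
\<close>

definition lambda_recursive_with ::
  "nat \<Rightarrow> (nat \<Rightarrow> 'a) \<Rightarrow> (nat \<Rightarrow> int \<Rightarrow> 'a) \<Rightarrow> (nat \<Rightarrow> int \<Rightarrow> 'a::comm_ring) \<Rightarrow> bool" where
  "lambda_recursive_with m p h lam \<longleftrightarrow>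
     triangular_support m lam \<and>
     (\<exists>c. \<forall>n k. 0 \<le> k \<and> k \<le> int (n div m) \<longrightarrow>
        (n < m \<and> k = 0 \<longrightarrow> lam n 0 = c n) \<and>
        (m \<le> n \<longrightarrow> lam n k = p n * lam (n - 1) k - h n k * lam (n - m) (k - 1)))"

definition lambda_poly :: "nat \<Rightarrow> (nat \<Rightarrow> int \<Rightarrow> 'a::comm_monoid_add) \<Rightarrow> nat \<Rightarrow> 'a poly" where
  "lambda_poly m lam n = (\<Sum>b = 0..n div m. monom (lam n (int b)) (n - m * b))"

text \<open>For \<open>k \<le> n div m\<close> the truncated difference \<open>n - k * m\<close> is the integer difference.\<close>

definition coeff_A ::
  "nat \<Rightarrow> (nat \<Rightarrow> 'a) \<Rightarrow> (nat \<Rightarrow> int \<Rightarrow> 'a::{comm_ring, comm_monoid_mult}) \<Rightarrow> nat \<Rightarrow> nat \<Rightarrow> 'a" where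
  "coeff_A m p lam n k =
     (let t = n - k * m in
        if m \<le> t then unit_inv (p t)
        else if 1 \<le> t then lam (t - 1) 0 * unit_inv (lam t 0)
        else 0)"

end

(* The recursion of lambda_1 says f_n = p_n x f_(n-1) - h_n f_(n-m) for n >= m, while f_n is the
   monomial lambda_1(n,0) x^n for n < m. Hence x f_(t-1) is a combination of f_t and f_(t-m) for
   every t >= 1. Multiplying the expansion of x^(n-1) by x expands x^n in the f_(n-mb), and the
   expansion is unique because the f_j have unit leading coefficients in distinct degrees. *)
theory Submission
  imports Defs
begin

lemma unit_mult_right_cancel:
  fixes a b c :: "'a::comm_monoid_mult"
  assumes "c dvd 1" and "a * c = b * c"
  shows "a = b"
  by (metis assms mult.assoc mult_1_right unit_inv_mult)

text \<open>The term \<open>g b\<close> moves to index \<open>b + 1\<close>. Nothing is lost at the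
  top because \<open>g N\<close> vanishes, and the vacated index 0 receives zero.\<close>

lemma sum_atMost_shift:
  fixes g :: "nat \<Rightarrow> 'a::comm_monoid_add"
  assumes "G 0 = 0" and "g N = 0" and "\<And>b. b < N \<Longrightarrow> G (Suc b) = g b"
  shows "(\<Sum>b=0..N. g b) = (\<Sum>b=0..N. G b)"
proof (cases N)
  case 0
  then show ?thesis using assms by simp
next
  case (Suc M)
  have "(\<Sum>b=0..N. G b) = (\<Sum>b=0..M. G (Suc b))"
    using assms(1) by (simp add: Suc sum.atLeast0_atMost_Suc_shift del: sum.cl_ivl_Suc)
  also have "\<dots> = (\<Sum>b=0..M. g b)"
    using assms(3) Suc by (intro sum.cong) auto
  finally show ?thesis using assms(2) Suc by simp
qed

lemma mult_le_of_le_div: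
  fixes b n m :: nat
  assumes "b \<le> n div m"
  shows "m * b \<le> n"
  by (metis assms div_times_less_eq_dividend le_trans mult.commute mult_le_mono2)

lemma triangular_support_beyond:
  assumes "triangular_support m lam" and "n div m < b"
  shows "lam n (int b) = 0"
  using assms unfolding triangular_support_def by simp

text \<open>The two ranges differ by at most one index, and an added index lies outside the support
  of row \<open>n - 1\<close>.\<close>

lemma sum_triangular_support_pred:
  fixes g :: "nat \<Rightarrow> 'b::comm_monoid_add"
  assumes "triangular_support m lam" and "\<And>b. lam (n - 1) (int b) = 0 \<Longrightarrow> g b = 0"
  shows "(\<Sum>b=0..(n - 1) div m. g b) = (\<Sum>b=0..n div m. g b)"
proof (rule sum.mono_neutral_left)
  show "{0..(n - 1) div m} \<subseteq> {0..n div m}"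
    by (simp add: div_le_mono)
  show "\<forall>b\<in>{0..n div m} - {0..(n - 1) div m}. g b = 0"
    using assms triangular_support_beyond by fastforce
qed simp

lemma smult_sum_right:
  fixes q :: "'b \<Rightarrow> 'a::comm_ring poly"
  shows "smult a (\<Sum>b\<in>B. q b) = (\<Sum>b\<in>B. smult a (q b))"
  by (rule poly_eqI) (simp add: coeff_sum sum_distrib_left)

lemma smult_1:
  fixes q :: "'a::{comm_ring, comm_monoid_mult} poly"
  shows "smult 1 q = q"
  by (rule poly_eqI) simp

lemma coeff_lambda_poly_top:
  assumes "m \<ge> 1"
  shows "coeff (lambda_poly m lam n) n = lam n 0"
proof -
  have "n - m * b = n \<longleftrightarrow> b = 0" if "b \<le> n div m" for b
  proof -
    have "m * b \<le> n"
      using that by (rule mult_le_of_le_div)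
    then have "n - m * b = n \<longleftrightarrow> m * b = 0" by linarith
    then show ?thesis using assms by simp
  qed
  then have "coeff (lambda_poly m lam n) n = (\<Sum>b=0..n div m. if b = 0 then lam n (int b) else 0)"
    unfolding lambda_poly_def coeff_sum by (intro sum.cong) auto
  then show ?thesis by simp
qed

lemma coeff_lambda_poly_above:
  "n < i \<Longrightarrow> coeff (lambda_poly m lam n) i = 0"
  unfolding lambda_poly_def coeff_sum by (intro sum.neutral) auto

text \<open>The system is triangular. At exponent \<open>n - m * b\<close> the terms with larger
  index vanish by degree, and those with smaller index agree by induction. What remains is index
  \<open>b\<close>, multiplied by the unit \<open>lam (n - m * b) 0\<close>.\<close>

lemma lambda_poly_expansion_unique:
  fixes d e :: "nat \<Rightarrow> 'a::{comm_ring, comm_monoid_mult}"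
  assumes m: "m \<ge> 1" and unit: "\<And>n. lam n 0 dvd 1"
    and eq: "(\<Sum>b=0..n div m. smult (d b) (lambda_poly m lam (n - m * b))) =
             (\<Sum>b=0..n div m. smult (e b) (lambda_poly m lam (n - m * b)))"
    and b: "b \<le> n div m"
  shows "d b = e b"
  using b
proof (induction b rule: less_induct)
  case (less b)
  let ?N = "n div m"
  let ?c = "\<lambda>b'. coeff (lambda_poly m lam (n - m * b')) (n - m * b)"
  have above: "?c b' = 0" if "b < b'" "b' \<le> ?N" for b'
  proof (rule coeff_lambda_poly_above)
    have "m * b < m * b'" using m that by simp
    then show "n - m * b' < n - m * b"
      using mult_le_of_le_div[OF that(2)] by linarith
  qed
  have "(\<Sum>b'=0..?N. d b' * ?c b') = (\<Sum>b'=0..?N. e b' * ?c b')"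
    using arg_cong[OF eq, of "\<lambda>q. coeff q (n - m * b)"] by (simp add: coeff_sum)
  moreover have "(\<Sum>b'\<in>{0..?N} - {b}. d b' * ?c b') = (\<Sum>b'\<in>{0..?N} - {b}. e b' * ?c b')"
  proof (rule sum.cong)
    fix b' assume "b' \<in> {0..?N} - {b}"
    then show "d b' * ?c b' = e b' * ?c b'"
      using less.IH above by (cases "b' < b") auto
  qed simp
  ultimately have "d b * ?c b = e b * ?c b"
    using less.prems by (simp add: sum.remove[of "{0..?N}" b])
  then show "d b = e b"
    using unit unit_mult_right_cancel by (metis coeff_lambda_poly_top[OF m])
qed

lemma lambda_recursive_withD:
  assumes "lambda_recursive_with m p h lam" and "m \<le> n" and "b \<le> n div m"
  shows "lam n (int b) = p n * lam (n - 1) (int b) - h n (int b) * lam (n - m) (int b - 1)"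
proof -
  have "0 \<le> int b \<and> int b \<le> int (n div m)" using assms(3) by simp
  then show ?thesis
    using assms(1,2) unfolding lambda_recursive_with_def by blast
qed

text \<open>Here \<open>pCons 0\<close> is multiplication by x. Writing the product over the index
  range and exponents of \<open>lambda_poly m lam n\<close> lets the recursion be checked term by
  term.\<close>

lemma pCons_lambda_poly:
  fixes lam :: "nat \<Rightarrow> int \<Rightarrow> 'a::{comm_ring, comm_monoid_mult}"
  assumes "triangular_support m lam" and "n \<ge> 1"
  shows "pCons 0 (lambda_poly m lam (n - 1)) =
         (\<Sum>b=0..n div m. monom (lam (n - 1) (int b)) (n - m * b))"
proof -
  have shift: "pCons 0 (\<Sum>b\<in>B. q b) = (\<Sum>b\<in>B. pCons 0 (q b))" for q :: "nat \<Rightarrow> 'a poly" and B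
    by (rule poly_eqI) (simp add: coeff_pCons coeff_sum split: nat.split)
  have "pCons 0 (lambda_poly m lam (n - 1)) =
        (\<Sum>b=0..(n - 1) div m. monom (lam (n - 1) (int b)) (n - m * b))"
    unfolding lambda_poly_def shift
  proof (rule sum.cong)
    fix b assume "b \<in> {0..(n - 1) div m}"
    then have "m * b \<le> n - 1" using mult_le_of_le_div by simp
    then have "n - m * b = Suc (n - 1 - m * b)" using assms(2) by linarith
    then show "pCons 0 (monom (lam (n - 1) (int b)) (n - 1 - m * b)) =
               monom (lam (n - 1) (int b)) (n - m * b)"
      by (simp add: monom_Suc)
  qed simp
  also have "\<dots> = (\<Sum>b=0..n div m. monom (lam (n - 1) (int b)) (n - m * b))"
    using assms(1) by (rule sum_triangular_support_pred) simp
  finally show ?thesis .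
qed

lemma lambda_poly_recursion:
  fixes p h :: "nat \<Rightarrow> 'a::{comm_ring, comm_monoid_mult}"
  assumes m: "m \<ge> 1" and rec: "lambda_recursive_with m p (\<lambda>n k. h n) lam" and n: "n \<ge> m"
  shows "lambda_poly m lam n =
         smult (p n) (pCons 0 (lambda_poly m lam (n - 1))) - smult (h n) (lambda_poly m lam (n - m))"
proof -
  have supp: "triangular_support m lam"
    using rec unfolding lambda_recursive_with_def by blast
  have div: "n div m = Suc ((n - m) div m)"
    using m n by (simp add: le_div_geq)
  \<comment> \<open>The sum is reindexed by one, since (n - m) - m b = n - m (b + 1). The new term
    at \<open>b = 0\<close> has second argument -1, where \<open>lam\<close> vanishes by triangular
    support.\<close>
  have "lambda_poly m lam (n - m) =
        (\<Sum>b=0..n div m. monom (lam (n - m) (int b - 1)) (n - m * b))"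
    using supp unfolding lambda_poly_def div triangular_support_def
    by (simp add: sum.atLeast0_atMost_Suc_shift algebra_simps del: sum.cl_ivl_Suc)
  then have "smult (p n) (pCons 0 (lambda_poly m lam (n - 1))) - smult (h n) (lambda_poly m lam (n - m))
    = (\<Sum>b=0..n div m. monom (p n * lam (n - 1) (int b) - h n * lam (n - m) (int b - 1)) (n - m * b))"
    using pCons_lambda_poly[OF supp, of n] m n
    by (simp only: smult_sum_right smult_monom diff_monom flip: sum_subtractf)
  also have "\<dots> = lambda_poly m lam n"
    unfolding lambda_poly_def
    using lambda_recursive_withD[OF rec n] by (intro sum.cong) auto
  finally show ?thesis by simp
qed

text \<open>The coefficient depends on the pair only through t, so an identity for x f_(t-1)
  supplies it for every pair with that t.\<close>

lemma coeff_A_0: "coeff_A m p lam n k = coeff_A m p lam (n - k * m) 0"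
  unfolding coeff_A_def by simp

text \<open>For \<open>t \<ge> m\<close> the recursion is solved for x f_(t-1) by dividing by the
  unit \<open>p t\<close>. For \<open>1 \<le> t < m\<close> both polynomials are single monomials,
  so only the ratio of their coefficients enters.\<close>

lemma pCons_lambda_poly_expansion:
  fixes p h :: "nat \<Rightarrow> 'a::{comm_ring, comm_monoid_mult}"
  assumes m: "m \<ge> 1" and rec: "lambda_recursive_with m p (\<lambda>n k. h n) lam"
    and unit: "\<And>n. lam n 0 dvd 1" and p: "\<And>n. n \<ge> m \<Longrightarrow> p n dvd 1"
    and t: "t \<ge> 1"
  shows "pCons 0 (lambda_poly m lam (t - 1)) =
         smult (coeff_A m p lam t 0) (lambda_poly m lam t) +
         (if m \<le> t then smult (h t * unit_inv (p t)) (lambda_poly m lam (t - m)) else 0)"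
proof (cases "m \<le> t")
  case True
  have "smult (unit_inv (p t)) (lambda_poly m lam t) =
        smult (p t * unit_inv (p t)) (pCons 0 (lambda_poly m lam (t - 1)))
        - smult (h t * unit_inv (p t)) (lambda_poly m lam (t - m))"
    unfolding lambda_poly_recursion[OF m rec True] smult_diff_right smult_smult
    by (simp add: mult.commute)
  also have "p t * unit_inv (p t) = 1"
    using p[OF True] by (rule unit_inv_mult)
  finally show ?thesis
    using True by (simp add: coeff_A_def smult_1)
next
  case False
  have "lam (t - 1) 0 = lam (t - 1) 0 * unit_inv (lam t 0) * lam t 0"
    by (metis unit unit_inv_mult mult.assoc mult.commute mult_1_right)
  moreover have "Suc (t - 1) = t" using t by simp
  ultimately show ?thesis
    using False t
    by (simp add: lambda_poly_def coeff_A_def smult_monom flip: monom_Suc)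
qed

theorem theorem4p1:
  fixes m :: nat
    and p h :: "nat \<Rightarrow> 'a::{comm_ring, comm_monoid_mult}"
    and lam1 lam3 :: "nat \<Rightarrow> int \<Rightarrow> 'a"
  assumes "m \<ge> 1"
    and "lambda_recursive_with m p (\<lambda>n k. h n) lam1"
    and "\<And>n. lam1 n 0 dvd 1"
    and "\<And>n. n \<ge> m \<Longrightarrow> p n dvd 1"
    and "triangular_support m lam3"
    and "\<And>n. monom 1 n =
           (\<Sum>b = 0..n div m. smult (lam3 n (int b)) (lambda_poly m lam1 (n - m * b)))"
    and "\<And>n. lam1 n 0 * lam3 n 0 = 1"
  shows "\<forall>n k. k \<le> n div m \<longrightarrow>
           lam3 n (int k) =
             (if k = 0 then unit_inv (lam1 n 0)
              else let s = n - (k - 1) * m in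
                coeff_A m p lam1 n k * lam3 (n - 1) (int k)
                + h s * unit_inv (p s) * lam3 (n - 1) (int k - 1))"
proof (intro allI impI)
  fix n k assume k: "k \<le> n div m"
  let ?f = "\<lambda>b. lambda_poly m lam1 (n - m * b)"
  let ?A = "\<lambda>b. coeff_A m p lam1 n b"
  let ?B = "\<lambda>b. h (n - m * b) * unit_inv (p (n - m * b))"
  let ?l = "\<lambda>b. lam3 (n - 1) b"
  show "lam3 n (int k) =
             (if k = 0 then unit_inv (lam1 n 0)
              else let s = n - (k - 1) * m in
                coeff_A m p lam1 n k * lam3 (n - 1) (int k)
                + h s * unit_inv (p s) * lam3 (n - 1) (int k - 1))"
  proof (cases "k = 0")
    case True
    have "lam3 n 0 * lam1 n 0 = unit_inv (lam1 n 0) * lam1 n 0"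
      using assms(7)[of n] unit_inv_mult[OF assms(3)[of n]] by (simp add: mult.commute)
    then show ?thesis
      using True unit_mult_right_cancel[OF assms(3)] by simp
  next
    case False
    then have n: "n \<ge> 1" using k by (cases n) auto
    \<comment> \<open>\<open>?g b\<close> is the part of x f_(t-1) along f_(t-m) for t = n - m b.
      The guard matters because for t < m truncated subtraction would turn \<open>?f (Suc b)\<close>
      into f_0. \<open>?G\<close> is the same family indexed by the polynomial it
      multiplies.\<close>
    let ?g = "\<lambda>b. if m \<le> n - m * b then smult (?l (int b) * ?B b) (?f (Suc b)) else 0"
    let ?G = "\<lambda>b. smult (?l (int b - 1) * ?B (b - 1)) (?f b)"
    have "monom 1 n = pCons 0 (monom (1::'a) (n - 1))"
      using n by (simp flip: monom_Suc)
    also have "\<dots> = (\<Sum>b=0..(n - 1) div m.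
        smult (?l (int b)) (pCons 0 (lambda_poly m lam1 (n - 1 - m * b))))"
      by (subst assms(6), rule poly_eqI) (simp add: coeff_pCons coeff_sum split: nat.split)
    also have "\<dots> = (\<Sum>b=0..(n - 1) div m. smult (?l (int b) * ?A b) (?f b) + ?g b)"
    proof (rule sum.cong)
      fix b assume "b \<in> {0..(n - 1) div m}"
      then have "m * b \<le> n - 1" using mult_le_of_le_div by simp
      then have "1 \<le> n - m * b" using n by linarith
      from pCons_lambda_poly_expansion[OF assms(1-4) this]
      show "smult (?l (int b)) (pCons 0 (lambda_poly m lam1 (n - 1 - m * b))) =
            smult (?l (int b) * ?A b) (?f b) + ?g b"
        by (simp add: coeff_A_0[of m p lam1 n b] smult_add_right algebra_simps)
    qed simp
    \<comment> \<open>An index is added only when m divides n; there t = 0, and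
      \<open>lam3 (n - 1)\<close> vanishes.\<close>
    also have "\<dots> = (\<Sum>b=0..n div m. smult (?l (int b) * ?A b) (?f b) + ?g b)"
      using assms(5) by (rule sum_triangular_support_pred) simp
    also have "\<dots> = (\<Sum>b=0..n div m. smult (?l (int b) * ?A b) (?f b)) + (\<Sum>b=0..n div m. ?g b)"
      by (rule sum.distrib)
    also have "(\<Sum>b=0..n div m. ?g b) = (\<Sum>b=0..n div m. ?G b)"
    proof (rule sum_atMost_shift)
      \<comment> \<open>At 0 the truncated \<open>b - 1\<close> is again 0, so the vanishing comes
        from \<open>lam3 (n - 1) (- 1) = 0\<close>.\<close>
      show "?G 0 = 0"
        using assms(5) by (simp add: triangular_support_def)
      \<comment> \<open>At the top index t is the remainder of n modulo m, so the guard in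
        \<open>?g\<close> fails.\<close>
      have "n - m * (n div m) < m"
        using assms(1) by (simp add: minus_mult_div_eq_mod)
      then show "?g (n div m) = 0" by simp
      fix b assume "b < n div m"
      then have "m * Suc b \<le> n" by (intro mult_le_of_le_div) simp
      then show "?G (Suc b) = ?g b" by auto
    qed
    finally have "monom 1 n = (\<Sum>b=0..n div m.
        smult (?l (int b) * ?A b + ?l (int b - 1) * ?B (b - 1)) (?f b))"
      by (simp add: smult_add_left sum.distrib)
    \<comment> \<open>Both sides now expand x^n in the same f_(n-mb), so coefficients may be
      compared at \<open>k\<close>. In \<open>?B (k - 1)\<close> the index
      \<open>n - m * (k - 1)\<close> is s.\<close>
    with assms(6)[of n] have "lam3 n (int k) = ?l (int k) * ?A k + ?l (int k - 1) * ?B (k - 1)"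
      by (intro lambda_poly_expansion_unique[where n = n and lam = lam1 and b = k, OF assms(1) assms(3) _ k])
        simp
    then show ?thesis
      using False by (simp add: Let_def mult.commute)
  qed
qed

end
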